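(* Let $R$ be a ring which is finitely generated as a module over a central subring $C \subseteq \operatorname{Cent}(R)$. Then the union of any countable chain of prime ideals of $R$ is a prime ideal of $R$.
   Context: Rings are associative with $1$, not necessarily commutative; ideals are two-sided. A prime ideal of a ring $R$ is a proper ideal $P$ such that for $a,b\in R$, $aRb\subseteq P$ implies $a\in P$ or $b\in P$. A chain of ideals is a nonempty family of ideals totally ordered by inclusion. $\operatorname{Cent}(R)$ denotes the center of $R$. *)

theory Defs
  imports "HOL-Algebra.Algebra" "HOL-Library.Countable_Set"
begin

definition ring_center :: "('a, 'b) ring_scheme \<Rightarrow> 'a set"
  where "ring_center R =
    {z \<in> carrier R. \<forall>x \<in> carrier R. z \<otimes>\<^bsub>R\<^esub> x = x \<otimes>\<^bsub>R\<^esub> z}"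

(* ring.Span R C [u1, ..., un] is C u1 + ... + C un; its definition does not require C
   to be a subfield. *)
definition fin_gen_over :: "'a set \<Rightarrow> ('a, 'b) ring_scheme \<Rightarrow> bool"
  where "fin_gen_over C R \<longleftrightarrow>
    (\<exists>Us. set Us \<subseteq> carrier R \<and> ring.Span R C Us = carrier R)"

(* The library's primeideal includes commutativity of the ring and is stated with
   elementwise products, so it is not the notion for noncommutative rings. *)
definition nc_primeideal :: "'a set \<Rightarrow> ('a, 'b) ring_scheme \<Rightarrow> bool"
  where "nc_primeideal P R \<longleftrightarrow>
    ideal P R \<and> P \<noteq> carrier R \<and>
    (\<forall>a \<in> carrier R. \<forall>b \<in> carrier R.
      {a \<otimes>\<^bsub>R\<^esub> r \<otimes>\<^bsub>R\<^esub> b |r. r \<in> carrier R} \<subseteq> P \<longrightarrow> a \<in> P \<or> b \<in> P)"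

lemma (in cring) nc_primeideal_iff_primeideal: "nc_primeideal P R \<longleftrightarrow> primeideal P R"
proof
  assume nc: "nc_primeideal P R"
  then have I: "ideal P R" by (simp add: nc_primeideal_def)
  show "primeideal P R"
  proof (rule primeidealI[OF I is_cring])
    show "carrier R \<noteq> P" using nc by (auto simp: nc_primeideal_def)
    fix a b assume ab: "a \<in> carrier R" "b \<in> carrier R" "a \<otimes> b \<in> P"
    have "a \<otimes> r \<otimes> b \<in> P" if "r \<in> carrier R" for r
    proof -
      have "a \<otimes> r \<otimes> b = r \<otimes> (a \<otimes> b)" using ab that by (simp add: m_ac)
      then show ?thesis using ideal.I_l_closed[OF I ab(3) that] by simp
    qed
    then show "a \<in> P \<or> b \<in> P" using nc ab unfolding nc_primeideal_def by blast
  qed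
next
  assume p: "primeideal P R"
  then interpret primeideal P R .
  have "a \<in> P \<or> b \<in> P"
    if ab: "a \<in> carrier R" "b \<in> carrier R"
      and s: "{a \<otimes> r \<otimes> b |r. r \<in> carrier R} \<subseteq> P" for a b
  proof -
    have "a \<otimes> \<one> \<otimes> b \<in> P" using s by blast
    then show ?thesis using I_prime ab by simp
  qed
  then show "nc_primeideal P R"
    using I_notcarr ideal_axioms unfolding nc_primeideal_def by blast
qed

end

(* Let u1, ..., un generate R over C. As C is central, a R b lies in an ideal I iff the
   n elements a ui b do. If a R b lies in the union of a chain, these finitely many elements
   already lie in one prime P of the chain, hence so does a R b, and P contains a or b. *)
theory Submission
  imports Defs
begin

context ring
begin

text \<open>Negation and multiplication by ring elements stay inside whichever member contains the
  given element. Only a sum involves two members, and there the chain condition provides one that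
  contains both summands.\<close>

lemma chain_Union_ideal:
  assumes ideals: "\<And>I. I \<in> \<I> \<Longrightarrow> ideal I R" and "\<I> \<noteq> {}" and chain: "subset.chain A \<I>"
  shows "ideal (\<Union>\<I>) R"
proof (rule idealI[OF ring_axioms])
  show "subgroup (\<Union>\<I>) (add_monoid R)"
  proof (rule add.subgroupI)
    show "\<Union>\<I> \<subseteq> carrier R"
      using ideals by (meson Sup_least additive_subgroup.a_subset ideal.axioms(1))
    obtain I where "I \<in> \<I>" using \<open>\<I> \<noteq> {}\<close> by blast
    then show "\<Union>\<I> \<noteq> {}"
      using additive_subgroup.zero_closed[OF ideal.axioms(1)[OF ideals]] by blast
  next
    fix x assume "x \<in> \<Union>\<I>"
    then show "\<ominus> x \<in> \<Union>\<I>"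
      using additive_subgroup.a_inv_closed[OF ideal.axioms(1)[OF ideals]] by (auto simp: a_inv_def)
  next
    fix x y assume "x \<in> \<Union>\<I>" "y \<in> \<Union>\<I>"
    then obtain I where "I \<in> \<I>" "x \<in> I" "y \<in> I"
      using chain unfolding subset_chain_def by blast
    then show "x \<oplus> y \<in> \<Union>\<I>"
      using additive_subgroup.a_closed[OF ideal.axioms(1)[OF ideals]] by blast
  qed
next
  fix x r assume "x \<in> \<Union>\<I>" "r \<in> carrier R"
  then show "r \<otimes> x \<in> \<Union>\<I>" "x \<otimes> r \<in> \<Union>\<I>"
    using ideal.I_l_closed[OF ideals] ideal.I_r_closed[OF ideals] by blast+
qed

text \<open>For fixed \<open>a\<close> and \<open>b\<close>, the map sending \<open>r\<close> to
  \<open>a \<otimes> r \<otimes> b\<close> is additive, and it commutes with multiplication by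
  central elements. Its values on a span are therefore combinations of its values on the generators,
  and an ideal absorbs the coefficients.\<close>

lemma ideal_sandwich_Span:
  assumes I: "ideal I R" and C: "C \<subseteq> ring_center R"
    and ab: "a \<in> carrier R" "b \<in> carrier R"
    and "set Us \<subseteq> carrier R"
    and "\<And>u. u \<in> set Us \<Longrightarrow> a \<otimes> u \<otimes> b \<in> I"
    and "r \<in> Span C Us"
  shows "a \<otimes> r \<otimes> b \<in> I"
  using assms(5-)
proof (induction Us arbitrary: r)
  case Nil
  then show ?case
    using ab I by (simp add: additive_subgroup.zero_closed ideal.axioms(1))
next
  case (Cons u Us)
  have C_carr: "C \<subseteq> carrier R" using C by (auto simp: ring_center_def)
  \<comment> \<open>\<open>Span C (u # Us)\<close> is built by line extension, as
    \<open>C u + Span C Us\<close>; this splits off the term handled by the hypothesis on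
    \<open>u\<close> from the one handled by induction.\<close>
  obtain c v where c: "c \<in> C" and v: "v \<in> Span C Us" and r: "r = c \<otimes> u \<oplus> v"
    using Cons.prems(3) by (auto simp: line_extension_mem_iff)
  have "Span C Us \<subseteq> carrier R"
    using C_carr Cons.prems(1) by (induct Us) (auto simp: line_extension_in_carrier)
  then have carr: "c \<in> carrier R" "u \<in> carrier R" "v \<in> carrier R"
    using c v C_carr Cons.prems(1) by auto
  \<comment> \<open>Centrality enters here: the coefficient moves to the left of \<open>a\<close>,
    out of the sandwich.\<close>
  have "a \<otimes> c = c \<otimes> a"
    using c C ab by (auto simp: ring_center_def)
  then have "a \<otimes> r \<otimes> b = c \<otimes> (a \<otimes> u \<otimes> b) \<oplus> a \<otimes> v \<otimes> b"
    unfolding r using ab carr by (simp add: l_distr r_distr flip: m_assoc)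
  moreover have "c \<otimes> (a \<otimes> u \<otimes> b) \<in> I"
    using Cons.prems(2) carr I by (simp add: ideal.I_l_closed)
  moreover have "a \<otimes> v \<otimes> b \<in> I"
    using Cons v by simp
  ultimately show ?case
    using I by (simp add: additive_subgroup.a_closed ideal.axioms(1))
qed

end

theorem proposition1p2:
  fixes R :: "('a, 'b) ring_scheme" and C :: "'a set" and \<P> :: "'a set set"
  assumes "ring R"
    and "subring C R" and "C \<subseteq> ring_center R"
    and "fin_gen_over C R"
    and "\<P> \<noteq> {}" and "countable \<P>"
    and "subset.chain {P. nc_primeideal P R} \<P>"
  shows "nc_primeideal (\<Union>\<P>) R"
proof -
  interpret ring R by fact
  have primes: "nc_primeideal P R" if "P \<in> \<P>" for P
    using assms(7) that by (auto simp: subset_chain_def)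
  then have ideals: "ideal P R" if "P \<in> \<P>" for P
    using that by (simp add: nc_primeideal_def)
  obtain Us where Us: "set Us \<subseteq> carrier R" "Span C Us = carrier R"
    using assms(4) unfolding fin_gen_over_def by blast
  \<comment> \<open>Properness passes to the union because it can be tested on the single element
    \<open>\<one>\<close>, which no proper ideal contains.\<close>
  have "\<one>\<^bsub>R\<^esub> \<notin> \<Union>\<P>"
    using primes ideal.one_imp_carrier unfolding nc_primeideal_def by blast
  then have proper: "\<Union>\<P> \<noteq> carrier R"
    using one_closed by blast
  have "a \<in> \<Union>\<P> \<or> b \<in> \<Union>\<P>"
    if ab: "a \<in> carrier R" "b \<in> carrier R"
      and sub: "{a \<otimes>\<^bsub>R\<^esub> r \<otimes>\<^bsub>R\<^esub> b |r. r \<in> carrier R} \<subseteq> \<Union>\<P>" for a b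
  proof -
    have "finite ((\<lambda>u. a \<otimes>\<^bsub>R\<^esub> u \<otimes>\<^bsub>R\<^esub> b) ` set Us)" by simp
    moreover have "(\<lambda>u. a \<otimes>\<^bsub>R\<^esub> u \<otimes>\<^bsub>R\<^esub> b) ` set Us \<subseteq> \<Union>\<P>"
      using sub Us(1) by blast
    \<comment> \<open>Finite generation is what makes one \<open>P\<close> suffice: a finite subset
      of the union of a nonempty chain lies in a single member.\<close>
    ultimately obtain P where P: "P \<in> \<P>" "(\<lambda>u. a \<otimes>\<^bsub>R\<^esub> u \<otimes>\<^bsub>R\<^esub> b) ` set Us \<subseteq> P"
      using finite_subset_Union_chain assms(5,7) by metis
    have "a \<otimes>\<^bsub>R\<^esub> r \<otimes>\<^bsub>R\<^esub> b \<in> P" if "r \<in> carrier R" for r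
      using ideal_sandwich_Span[OF ideals[OF P(1)] assms(3) ab Us(1)] P(2) Us(2) that by blast
    then have "{a \<otimes>\<^bsub>R\<^esub> r \<otimes>\<^bsub>R\<^esub> b |r. r \<in> carrier R} \<subseteq> P" by blast
    then show ?thesis
      using primes[OF P(1)] ab P(1) unfolding nc_primeideal_def by blast
  qed
  then show ?thesis
    using chain_Union_ideal[OF ideals assms(5,7)] proper unfolding nc_primeideal_def by blast
qed

end
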